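(* Let $n=5$ and $t=(1,1,1,1,1,0)$. Let $s_1,\dots,s_{11}$ be the standard generators of the toric ideal $I_{G_5^t}$, namely $$\begin{aligned} s_1&=x_2x_3-x_0x_4, & s_2&=x_3x_5-x_0x_6, & s_3&=x_4x_5-x_2x_6, & s_4&=x_5x_7-x_2x_8,\\ s_5&=x_6x_7-x_4x_8, & s_6&=x_7x_9-x_4x_{10}, & s_7&=x_8x_9-x_6x_{10}, & s_8&=x_9x_{11}-x_6x_{12},\\ s_9&=x_{10}x_{11}-x_8x_{12}, & s_{10}&=x_{11}x_{13}-x_6x_{14}, & s_{11}&=x_{12}x_{13}-x_9x_{14}. \end{aligned}$$ Then there is no lattice $D$ on the set $\{x_0,x_2,x_3,\dots,x_{14}\}$ such that the set $\{s_1,\dots,s_{11}\}$ is equal, up to sign, to the complete set of standard generators of $D$.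
   Context: A lattice is a partially ordered set in which any two elements $x,y$ have a join (least upper bound) $x\vee y$ and a meet (greatest lower bound) $x\wedge y$. For a lattice $D$ whose elements are regarded as variables of a polynomial ring over a field $k$, a standard generator of (the join-meet ideal of) $D$ is a nonzero polynomial of the form $xy-(x\vee y)(x\wedge y)$ or $(x\vee y)(x\wedge y)-xy$ with $x,y\in D$ (then $x,y$ are necessarily incomparable). "Equal up to sign" means that $\{\pm s_1,\dots,\pm s_{11}\}$ is exactly the set of all standard generators of $D$. The generators $s_1,\dots,s_{11}$ are, up to sign, the $2\times2$ minors with all four entries nonzero of the array $L_5^{(1,1,1,1,1,0)}$ whose rows are (with $\cdot$ an empty position) $(x_0,x_2,x_5,\cdot,\cdot)$, $(x_3,x_4,x_6,x_9,x_{13})$, $(\cdot,x_7,x_8,x_{10},\cdot)$, $(\cdot,\cdot,x_{11},x_{12},x_{14})$. They generate $I_{G_5^t}$, the toric ideal of the bipartite graph $G_5^t$ with a vertex for each row and column of this array and an edge for each nonzero entry. *)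

theory Defs
  imports "HOL-Algebra.Lattice" "HOL-Library.Poly_Mapping"
begin

text \<open>
  The polynomial ring over \<open>'k\<close> with variables indexed by the type \<open>'a\<close>: a polynomial is a
  finitely supported map from monomials (finitely supported exponent vectors) to coefficients.
\<close>

type_synonym ('a, 'k) mpoly = "('a \<Rightarrow>\<^sub>0 nat) \<Rightarrow>\<^sub>0 'k"

definition var :: "'a \<Rightarrow> ('a, 'k::field) mpoly" (\<open>\<x>\<close>)
  where "\<x> i = Poly_Mapping.single (Poly_Mapping.single i 1) 1"

definition standard_generators :: "'a gorder \<Rightarrow> ('a, 'k::field) mpoly set"
  where "standard_generators D =
    {f. f \<noteq> 0 \<and> (\<exists>x\<in>carrier D. \<exists>y\<in>carrier D.
          f = \<x> x * \<x> y - \<x> (x \<squnion>\<^bsub>D\<^esub> y) * \<x> (x \<sqinter>\<^bsub>D\<^esub> y) \<or>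
          f = \<x> (x \<squnion>\<^bsub>D\<^esub> y) * \<x> (x \<sqinter>\<^bsub>D\<^esub> y) - \<x> x * \<x> y)}"

definition up_to_sign :: "'r::ring set \<Rightarrow> 'r set"
  where "up_to_sign S = S \<union> uminus ` S"

text \<open>The generators \<open>s\<^sub>1, \<dots>, s\<^sub>1\<^sub>1\<close> of the toric ideal, in this order.\<close>

definition toric_generators :: "(nat, 'k::field) mpoly list"
  where "toric_generators =
    [\<x> 2 * \<x> 3 - \<x> 0 * \<x> 4,
     \<x> 3 * \<x> 5 - \<x> 0 * \<x> 6,
     \<x> 4 * \<x> 5 - \<x> 2 * \<x> 6,
     \<x> 5 * \<x> 7 - \<x> 2 * \<x> 8,
     \<x> 6 * \<x> 7 - \<x> 4 * \<x> 8,
     \<x> 7 * \<x> 9 - \<x> 4 * \<x> 10,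
     \<x> 8 * \<x> 9 - \<x> 6 * \<x> 10,
     \<x> 9 * \<x> 11 - \<x> 6 * \<x> 12,
     \<x> 10 * \<x> 11 - \<x> 8 * \<x> 12,
     \<x> 11 * \<x> 13 - \<x> 6 * \<x> 14,
     \<x> 12 * \<x> 13 - \<x> 9 * \<x> 14]"

text \<open>
  The array \<open>L\<^sub>5\<close> for \<open>t = (1,1,1,1,1,0)\<close>, with \<open>0\<close> in the empty positions. Its \<open>2 \<times> 2\<close> minors
  without zero entries are the polynomials above, up to sign.
\<close>

definition L5 :: "(nat, 'k::field) mpoly list list"
  where "L5 =
    [[\<x> 0, \<x> 2, \<x> 5,  0,    0],
     [\<x> 3, \<x> 4, \<x> 6,  \<x> 9,  \<x> 13],
     [0,   \<x> 7, \<x> 8,  \<x> 10, 0],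
     [0,   0,   \<x> 11, \<x> 12, \<x> 14]]"

definition nonzero_minors :: "'r::ring list list \<Rightarrow> 'r set"
  where "nonzero_minors A =
    {A!i!j * A!k!l - A!i!l * A!k!j | i j k l.
       i < k \<and> k < length A \<and> j < l \<and> l < length (A!i) \<and> l < length (A!k) \<and>
       A!i!j \<noteq> 0 \<and> A!k!l \<noteq> 0 \<and> A!i!l \<noteq> 0 \<and> A!k!j \<noteq> 0}"

lemma var_nonzero [simp]: "(\<x> i :: ('a, 'k::field) mpoly) \<noteq> 0"
  unfolding var_def by (metis lookup_single_eq lookup_zero zero_neq_one)

lemma up_to_sign_toric_generators:
  "up_to_sign (set toric_generators) = up_to_sign (nonzero_minors (L5 :: (nat, 'k::field) mpoly list list))"
proof -
  let ?A = "L5 :: (nat, 'k) mpoly list list"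
  define E where "E i j = ?A ! i ! j" for i j
  have rows: "length ?A = 4" "\<And>i. i < 4 \<Longrightarrow> length (?A ! i) = 5"
    by (auto simp: L5_def nth_Cons' numeral_eq_Suc less_Suc_eq)
  have E: 
    "E 0 0 = \<x> 0" "E 0 1 = \<x> 2" "E 0 2 = \<x> 5" "E 0 3 = 0" "E 0 4 = 0"
    "E 1 0 = \<x> 3" "E 1 1 = \<x> 4" "E 1 2 = \<x> 6" "E 1 3 = \<x> 9" "E 1 4 = \<x> 13"
    "E 2 0 = 0" "E 2 1 = \<x> 7" "E 2 2 = \<x> 8" "E 2 3 = \<x> 10" "E 2 4 = 0"
    "E 3 0 = 0" "E 3 1 = 0" "E 3 2 = \<x> 11" "E 3 3 = \<x> 12" "E 3 4 = \<x> 14"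
    by (simp_all add: E_def L5_def)
  define M where "M i k j l = (if E i j \<noteq> 0 \<and> E k l \<noteq> 0 \<and> E i l \<noteq> 0 \<and> E k j \<noteq> 0
    then {E i j * E k l - E i l * E k j} else {})" for i j k l
  have "nonzero_minors ?A = {d. \<exists>i j k l. i < k \<and> k < 4 \<and> j < l \<and> l < 5 \<and> d \<in> M i k j l}"
    unfolding nonzero_minors_def M_def E_def
    by (intro Collect_cong ex_cong1) (auto simp: rows split: if_splits)
  also have "\<dots> = (\<Union>(i, k)\<in>{(0,1),(0,2),(0,3),(1,2),(1,3),(2,3)}.
      \<Union>(j, l)\<in>{(0,1),(0,2),(0,3),(0,4),(1,2),(1,3),(1,4),(2,3),(2,4),(3,4)}. M i k j l)"
    (is "_ = (\<Union>(i, k)\<in>?R. \<Union>(j, l)\<in>?C. M i k j l)")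
  proof -
    have gen: "{d. \<exists>i j k l. (i, k) \<in> R \<and> (j, l) \<in> C \<and> d \<in> M i k j l} =
        (\<Union>(i, k)\<in>R. \<Union>(j, l)\<in>C. M i k j l)" for R C
      by blast
    have R: "i < k \<and> k < 4 \<longleftrightarrow> (i, k) \<in> ?R" for i k :: nat
      by (auto simp: numeral_eq_Suc less_Suc_eq)
    have C: "j < l \<and> l < 5 \<longleftrightarrow> (j, l) \<in> ?C" for j l :: nat
      proof (cases "l < 5")
      case True
      then consider "l = 0" | "l = 1" | "l = 2" | "l = 3" | "l = 4" by linarith
      then show ?thesis by cases (auto simp: numeral_eq_Suc less_Suc_eq)
    qed auto
    have "{d. \<exists>i j k l. i < k \<and> k < 4 \<and> j < l \<and> l < 5 \<and> d \<in> M i k j l} =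
        {d. \<exists>i j k l. (i, k) \<in> ?R \<and> (j, l) \<in> ?C \<and> d \<in> M i k j l}"
      unfolding R[symmetric] C[symmetric] by simp
    also note gen
    finally show ?thesis .
  qed
  also have "\<dots> = uminus ` set toric_generators"
    by (simp add: M_def E[simplified] toric_generators_def)
      (rule equalityI; simp only: insert_subset empty_subsetI insert_iff mult.commute simp_thms)
  finally show ?thesis
    by (simp add: up_to_sign_def image_image Un_commute)
qed

end

theory Submission
  imports Defs
begin

text \<open>
  A binomial with two distinct quadratic monomials determines its monomials, each monomial determines
  its two variables, and the standard generators come exactly from the incomparable pairs. So a lattice
  with the given generators is an order in which, for each of the eleven minors, one diagonal of the
  minor is incomparable and has the other diagonal as its meet and join, while any two elements that
  are not the diagonal of a minor are comparable. This combinatorial content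
  (\<open>square_order\<close>) is contradictory.

  The contradiction rests on two observations about one minor. An element above both ends of one
  diagonal is above the whole minor (\<open>diagonal_bounds\<close>), because one of the diagonals is
  incomparable with its join on the other. And an element that is a diagonal partner of none of the
  four corners cannot lie between them: it is above all four or below all four
  (\<open>above_square\<close>). Since neighbouring minors share corners, a single comparison spreads
  through much of the array.

  Start with \<open>13\<close>, whose only diagonal partners are \<open>11\<close> and \<open>12\<close>. The minors
  that avoid row 4 and column 5 are linked by shared corners, so \<open>13\<close> is above all of
  their corners or below all of them; the hypotheses are self-dual, so take the first case. Then
  \<open>14 \<preceq> 13\<close> is impossible, because bounds spread from \<open>14\<close> as well. Once
  \<open>13 \<preceq> 14\<close> is known, \<open>11\<close> and \<open>12\<close> inherit lower bounds from rows 1 to 3, and meets with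
  \<open>13\<close> turn these into lower bounds of \<open>6\<close> and \<open>9\<close>. The elements
  \<open>6\<close> and \<open>9\<close> are themselves comparable, and either direction is impossible.
\<close>

section \<open>Squares in an order\<close>

definition diamond :: "('a \<Rightarrow> 'a \<Rightarrow> bool) \<Rightarrow> 'a \<Rightarrow> 'a \<Rightarrow> 'a \<Rightarrow> 'a \<Rightarrow> bool"
  where "diamond R a b l u \<longleftrightarrow> \<not> R a b \<and> \<not> R b a \<and> R l a \<and> R l b \<and> R a u \<and> R b u \<and>
    (\<forall>z. R z a \<longrightarrow> R z b \<longrightarrow> R z l) \<and> (\<forall>z. R a z \<longrightarrow> R b z \<longrightarrow> R u z)"

text \<open>
  The corners are grouped by diagonals, \<open>a\<close> opposite to \<open>b\<close> and \<open>c\<close>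
  opposite to \<open>d\<close>. The four cases are needed because a generator is known only up to sign,
  and its second monomial does not tell the join from the meet.
\<close>

definition square :: "('a \<Rightarrow> 'a \<Rightarrow> bool) \<Rightarrow> 'a \<Rightarrow> 'a \<Rightarrow> 'a \<Rightarrow> 'a \<Rightarrow> bool"
  where "square R a b c d \<longleftrightarrow>
    diamond R a b c d \<or> diamond R a b d c \<or> diamond R c d a b \<or> diamond R c d b a"

lemma diamond_converse: "diamond R\<inverse>\<inverse> a b l u = diamond R a b u l"
  by (auto simp: diamond_def)

lemma square_converse: "square R\<inverse>\<inverse> a b c d = square R a b c d"
  by (auto simp: square_def diamond_converse)

definition squares :: "(nat \<times> nat \<times> nat \<times> nat) list"
  where "squares =
    [(2, 3, 0, 4), (3, 5, 0, 6), (4, 5, 2, 6), (5, 7, 2, 8), (6, 7, 4, 8), (7, 9, 4, 10),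
     (8, 9, 6, 10), (9, 11, 6, 12), (10, 11, 8, 12), (11, 13, 6, 14), (12, 13, 9, 14)]"

text \<open>
  Ordered pairs rather than two-element sets, so that instances with numerals are decided by rewriting.
\<close>

definition diagonal :: "nat \<Rightarrow> nat \<Rightarrow> bool"
  where "diagonal x y \<longleftrightarrow>
    (\<exists>(a, b, c, d) \<in> set squares. (x, y) \<in> {(a, b), (b, a), (c, d), (d, c)})"

lemma toric_generators_squares:
  "toric_generators = map (\<lambda>(a, b, c, d). \<x> a * \<x> b - \<x> c * \<x> d) squares"
  by (simp add: toric_generators_def squares_def)

text \<open>
  What the generators say about the order of the lattice. The order is meant to be false outside
  the carrier, hence reflexive only on it, which makes the quantifiers over all natural
  numbers in \<open>diamond\<close> range over the carrier only.
\<close>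

locale square_order =
  fixes le :: "nat \<Rightarrow> nat \<Rightarrow> bool" (infix \<open>\<preceq>\<close> 50)
  assumes trans: "x \<preceq> y \<Longrightarrow> y \<preceq> z \<Longrightarrow> x \<preceq> z"
    and antisym: "x \<preceq> y \<Longrightarrow> y \<preceq> x \<Longrightarrow> x = y"
    and square: "(a, b, c, d) \<in> set squares \<Longrightarrow> square (\<preceq>) a b c d"
    and comparable: "x \<in> {0} \<union> {2..14} \<Longrightarrow> y \<in> {0} \<union> {2..14} \<Longrightarrow> \<not> diagonal x y \<Longrightarrow>
      x \<preceq> y \<or> y \<preceq> x"
begin

text \<open>Duality, which reduces the case \<open>13 \<preceq> 4\<close> to \<open>4 \<preceq> 13\<close>.\<close>

lemma converse: "square_order (\<preceq>)\<inverse>\<inverse>"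
proof
  show "x = y" if "(\<preceq>)\<inverse>\<inverse> x y" "(\<preceq>)\<inverse>\<inverse> y x" for x y
    using antisym that by simp
  show "(\<preceq>)\<inverse>\<inverse> x z" if "(\<preceq>)\<inverse>\<inverse> x y" "(\<preceq>)\<inverse>\<inverse> y z" for x y z
    using trans that by (metis conversepD conversepI)
  show "square (\<preceq>)\<inverse>\<inverse> a b c d" if "(a, b, c, d) \<in> set squares" for a b c d
    using square[OF that] by (simp add: square_converse)
  show "(\<preceq>)\<inverse>\<inverse> x y \<or> (\<preceq>)\<inverse>\<inverse> y x"
    if "x \<in> {0} \<union> {2..14}" "y \<in> {0} \<union> {2..14}" "\<not> diagonal x y" for x y
    using comparable[OF that] by auto
qed

text \<open>
  All four sides run from the meet or to the join, so going around the square they point away from one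
  corner and towards the opposite one. In the array this means that within a minor both rows
  are ordered the same way, and so are both columns.
\<close>

lemma opposite_sides_parallel:
  assumes "square (\<preceq>) a b c d"
  shows "a \<preceq> c \<longleftrightarrow> d \<preceq> b" "a \<preceq> d \<longleftrightarrow> c \<preceq> b" "c \<preceq> a \<longleftrightarrow> b \<preceq> d" "d \<preceq> a \<longleftrightarrow> b \<preceq> c"
  using assms trans unfolding square_def diamond_def by metis+

text \<open>
  A corner above both ends of the other diagonal can only be the join: were it one of the incomparable
  elements, the other diagonal would contain the join, which is not below it.
\<close>

lemma incomparable_below_corner:
  assumes "square (\<preceq>) a b c d"
  shows "a \<preceq> c \<Longrightarrow> b \<preceq> c \<Longrightarrow> \<not> a \<preceq> b \<and> \<not> b \<preceq> a"
    and "a \<preceq> d \<Longrightarrow> b \<preceq> d \<Longrightarrow> \<not> a \<preceq> b \<and> \<not> b \<preceq> a"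
    and "c \<preceq> a \<Longrightarrow> d \<preceq> a \<Longrightarrow> \<not> c \<preceq> d \<and> \<not> d \<preceq> c"
    and "c \<preceq> b \<Longrightarrow> d \<preceq> b \<Longrightarrow> \<not> c \<preceq> d \<and> \<not> d \<preceq> c"
  using assms trans unfolding square_def diamond_def by metis+

text \<open>
  For the incomparable diagonal this is the universal property of join and meet; the other diagonal
  contains the join and the meet themselves.
\<close>

lemma diagonal_bounds:
  assumes "square (\<preceq>) a b c d"
  shows "a \<preceq> z \<Longrightarrow> b \<preceq> z \<Longrightarrow> c \<preceq> z \<and> d \<preceq> z"
    and "c \<preceq> z \<Longrightarrow> d \<preceq> z \<Longrightarrow> a \<preceq> z \<and> b \<preceq> z"
    and "z \<preceq> a \<Longrightarrow> z \<preceq> b \<Longrightarrow> z \<preceq> c \<and> z \<preceq> d"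
    and "z \<preceq> c \<Longrightarrow> z \<preceq> d \<Longrightarrow> z \<preceq> a \<and> z \<preceq> b"
  using assms trans unfolding square_def diamond_def by metis+

text \<open>
  Such a \<open>z\<close> is comparable to both ends of the incomparable diagonal. It cannot lie between
  them, so it bounds both from the same side and hence bounds the whole square from that side; the given
  \<open>v \<preceq> z\<close> decides which.
\<close>

lemma above_square:
  assumes sq: "(a, b, c, d) \<in> set squares"
    and z: "z \<in> {0} \<union> {2..14}" "\<forall>v\<in>{a, b, c, d}. \<not> diagonal v z"
    and v: "v \<in> {a, b, c, d}" "v \<preceq> z"
  shows "\<forall>v\<in>{a, b, c, d}. v \<preceq> z"
proof -
  have mem: "{a, b, c, d} \<subseteq> {0} \<union> {2..14}"
    using sq by (auto simp: squares_def)
  then have comp: "v \<preceq> z \<or> z \<preceq> v" if "v \<in> {a, b, c, d}" for v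
    using comparable[of v z] z that by auto
  have S: "square (\<preceq>) a b c d"
    by (rule square[OF sq])
  have split: "(\<forall>v\<in>{a, b, c, d}. v \<preceq> z) \<or> (\<forall>v\<in>{a, b, c, d}. z \<preceq> v)"
  proof -
    consider "\<not> a \<preceq> b" "\<not> b \<preceq> a" | "\<not> c \<preceq> d" "\<not> d \<preceq> c"
      using S unfolding square_def diamond_def by blast
    then show ?thesis
    proof cases
      case 1
      then have "a \<preceq> z \<and> b \<preceq> z \<or> z \<preceq> a \<and> z \<preceq> b"
        using comp[of a] comp[of b] trans by blast
      then show ?thesis using diagonal_bounds[OF S] by blast
    next
      case 2
      then have "c \<preceq> z \<and> d \<preceq> z \<or> z \<preceq> c \<and> z \<preceq> d"
        using comp[of c] comp[of d] trans by blast
      then show ?thesis using diagonal_bounds[OF S] by blast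
    qed
  qed
  \<comment> \<open>A corner always has its opposite corner as a diagonal partner, so \<open>v\<close>
    is not \<open>z\<close> and is strictly below it.\<close>
  have "\<exists>w\<in>{a, b, c, d}. diagonal w v"
    using v(1) bexI[OF _ sq] unfolding diagonal_def by fastforce
  then have "z \<noteq> v"
    using v(1) z(2) by auto
  then have "\<not> z \<preceq> v"
    using antisym[OF v(2)] by auto
  then show ?thesis
    using split v(1) by blast
qed

text \<open>
  The heart of the argument. The hypothesis makes \<open>13\<close> an upper bound of the minors that
  avoid row 4 and column 5, and every further step is either such a spreading of bounds or the
  observation that a particular diagonal must be the incomparable one.
\<close>

lemma four_not_below_thirteen: "\<not> 4 \<preceq> 13"
proof
  assume "4 \<preceq> 13"
  note s1 = square[of 2 3 0 4, unfolded squares_def, simplified]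
  note s2 = square[of 3 5 0 6, unfolded squares_def, simplified]
  note s3 = square[of 4 5 2 6, unfolded squares_def, simplified]
  note s4 = square[of 5 7 2 8, unfolded squares_def, simplified]
  note s6 = square[of 7 9 4 10, unfolded squares_def, simplified]
  note s7 = square[of 8 9 6 10, unfolded squares_def, simplified]
  note s9 = square[of 10 11 8 12, unfolded squares_def, simplified]
  note s10 = square[of 11 13 6 14, unfolded squares_def, simplified]
  note s11 = square[of 12 13 9 14, unfolded squares_def, simplified]
  note concrete = squares_def diagonal_def
  have "\<forall>v\<in>{2, 3, 0, 4}. v \<preceq> 13"
    by (rule above_square[where v = 4]) (simp_all add: concrete \<open>4 \<preceq> 13\<close>)
  moreover from this have "\<forall>v\<in>{3, 5, 0, 6}. v \<preceq> 13"
    by (intro above_square[where v = 3]) (simp_all add: concrete)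
  moreover from this have "\<forall>v\<in>{5, 7, 2, 8}. v \<preceq> 13"
    by (intro above_square[where v = 5]) (simp_all add: concrete)
  moreover from this have "\<forall>v\<in>{7, 9, 4, 10}. v \<preceq> 13"
    by (intro above_square[where v = 7]) (simp_all add: concrete)
  ultimately have below13: "0 \<preceq> 13" "2 \<preceq> 13" "3 \<preceq> 13" "4 \<preceq> 13" "5 \<preceq> 13" "6 \<preceq> 13" "7 \<preceq> 13"
    "8 \<preceq> 13" "9 \<preceq> 13" "10 \<preceq> 13"
    by simp_all
  have "11 \<preceq> 14" "12 \<preceq> 14"
    using opposite_sides_parallel[OF s10] opposite_sides_parallel[OF s11] below13 by simp_all
  \<comment> \<open>Otherwise \<open>13\<close> is the top of its minor with \<open>6\<close> and \<open>14\<close>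
    incomparable. But \<open>14\<close> bounds enough of the array to be above
    \<open>4\<close> and \<open>5\<close>, hence above the opposite corner \<open>6\<close>.\<close>
  have "\<not> 14 \<preceq> 13"
  proof
    assume "14 \<preceq> 13"
    then have "\<not> 6 \<preceq> 14"
      using incomparable_below_corner[OF s10] below13 by blast
    have "\<forall>v\<in>{10, 11, 8, 12}. v \<preceq> 14"
      by (intro above_square[where v = 11]) (simp_all add: concrete \<open>11 \<preceq> 14\<close>)
    then have below14: "\<forall>v\<in>{5, 7, 2, 8}. v \<preceq> 14"
      by (intro above_square[where v = 8]) (simp_all add: concrete)
    then have "\<forall>v\<in>{2, 3, 0, 4}. v \<preceq> 14"
      by (intro above_square[where v = 2]) (simp_all add: concrete)
    then have "4 \<preceq> 14" "5 \<preceq> 14"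
      using below14 by simp_all
    then show False
      using diagonal_bounds[OF s3] \<open>\<not> 6 \<preceq> 14\<close> by blast
  qed
  then have "13 \<preceq> 14"
    using comparable[of 13 14] by (simp_all add: concrete)
  have "6 \<preceq> 11" "9 \<preceq> 12"
    using opposite_sides_parallel[OF s10] opposite_sides_parallel[OF s11] \<open>13 \<preceq> 14\<close> by simp_all
  have "\<not> 11 \<preceq> 13"
    using incomparable_below_corner[OF s10] \<open>11 \<preceq> 14\<close> \<open>13 \<preceq> 14\<close> by blast
  then have "8 \<preceq> 11"
    using comparable[of 8 11] trans[of 11 8 13] below13 by (auto simp: concrete)
  \<comment> \<open>Lower bounds of \<open>11\<close> that are also below \<open>13\<close> are below
    the meet \<open>6\<close> of the two; likewise \<open>9\<close> is the meet of \<open>12\<close> and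
    \<open>13\<close>.\<close>
  have "\<forall>v\<in>{3, 5, 0, 6}. v \<preceq> 11"
    by (intro above_square[where v = 6]) (simp_all add: concrete \<open>6 \<preceq> 11\<close>)
  moreover have "\<forall>v\<in>{4, 5, 2, 6}. v \<preceq> 11"
    by (intro above_square[where v = 6]) (simp_all add: concrete \<open>6 \<preceq> 11\<close>)
  moreover have "\<forall>v\<in>{5, 7, 2, 8}. v \<preceq> 11"
    by (intro above_square[where v = 8]) (simp_all add: concrete \<open>8 \<preceq> 11\<close>)
  ultimately have below6: "0 \<preceq> 6" "2 \<preceq> 6" "3 \<preceq> 6" "4 \<preceq> 6" "5 \<preceq> 6" "7 \<preceq> 6" "8 \<preceq> 6"
    using diagonal_bounds(3)[OF s10] below13 by simp_all
  have "\<forall>v\<in>{7, 9, 4, 10}. v \<preceq> 12"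
    by (intro above_square[where v = 9]) (simp_all add: concrete \<open>9 \<preceq> 12\<close>)
  then have "4 \<preceq> 9" "10 \<preceq> 9"
    using diagonal_bounds(3)[OF s11] below13 by simp_all
  consider "9 \<preceq> 6" | "6 \<preceq> 9"
    using comparable[of 6 9] by (auto simp: concrete)
  then show False
  proof cases
    \<comment> \<open>Now \<open>6\<close> is the join of the incomparable elements \<open>8\<close> and
      \<open>9\<close>; comparing \<open>5\<close> with them makes \<open>5\<close> a common upper bound,
      although \<open>5 \<preceq> 6\<close>.\<close>
    case 1
    have "\<not> 9 \<preceq> 8"
      using incomparable_below_corner[OF s7] \<open>9 \<preceq> 6\<close> \<open>8 \<preceq> 6\<close> by blast
    have "\<not> 5 \<preceq> 9"
      using diagonal_bounds[OF s3, of 9] \<open>4 \<preceq> 9\<close> \<open>9 \<preceq> 6\<close> antisym[of 6 9] by auto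
    then have "9 \<preceq> 5"
      using comparable[of 5 9] by (simp_all add: concrete)
    then have "8 \<preceq> 5"
      using comparable[of 5 8] trans[of 9 5 8] \<open>\<not> 9 \<preceq> 8\<close> by (auto simp: concrete)
    then have "6 \<preceq> 5"
      using diagonal_bounds[OF s7, of 5] \<open>9 \<preceq> 5\<close> by blast
    then show False
      using antisym[of 5 6] \<open>5 \<preceq> 6\<close> by simp
  next
    \<comment> \<open>Now \<open>9\<close> is the join of \<open>6\<close> and \<open>10\<close>, and also of
      \<open>4\<close> and \<open>10\<close>. Both \<open>2\<close> and \<open>3\<close> are below
      \<open>10\<close>, hence so is \<open>4\<close>, which should be incomparable to it.\<close>
    case 2
    have "\<not> 10 \<preceq> 6"
      using incomparable_below_corner[OF s7] \<open>6 \<preceq> 9\<close> \<open>10 \<preceq> 9\<close> by blast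
    then have "5 \<preceq> 10"
      using comparable[of 5 10] trans[of 10 5 6] \<open>5 \<preceq> 6\<close> by (auto simp: concrete)
    then have "5 \<preceq> 8"
      using diagonal_bounds[OF s7, of 5] \<open>5 \<preceq> 6\<close> by blast
    then have "2 \<preceq> 7"
      using opposite_sides_parallel[OF s4] by blast
    moreover have "7 \<preceq> 10"
      using opposite_sides_parallel[OF s6] \<open>4 \<preceq> 9\<close> by blast
    ultimately have "2 \<preceq> 10"
      by (rule trans)
    have "\<not> 5 \<preceq> 3"
      using incomparable_below_corner[OF s2] \<open>3 \<preceq> 6\<close> \<open>5 \<preceq> 6\<close> by blast
    then have "3 \<preceq> 10"
      using comparable[of 3 10] trans[of 5 10 3] \<open>5 \<preceq> 10\<close> by (auto simp: concrete)
    then have "4 \<preceq> 10"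
      using diagonal_bounds[OF s1, of 10] \<open>2 \<preceq> 10\<close> by blast
    then show False
      using incomparable_below_corner[OF s6] \<open>4 \<preceq> 9\<close> \<open>10 \<preceq> 9\<close> by blast
  qed
qed

end

lemma no_square_order: "\<not> square_order R"
proof
  assume le: "square_order R"
  then have "R 4 13 \<or> R 13 4"
    using square_order.comparable[of R 4 13]
    by (auto simp: diagonal_def squares_def)
  moreover have "\<not> R 13 4"
    using square_order.four_not_below_thirteen[OF square_order.converse[OF le]] by simp
  ultimately show False
    using square_order.four_not_below_thirteen[OF le] by blast
qed

section \<open>Reading the order off the generators\<close>

abbreviation quadric :: "'a \<Rightarrow> 'a \<Rightarrow> 'a \<Rightarrow> 'a \<Rightarrow> ('a, 'k::field) mpoly"
  where "quadric a b c d \<equiv> \<x> a * \<x> b - \<x> c * \<x> d"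

lemma var_mult:
  "\<x> a * \<x> b = Poly_Mapping.single (Poly_Mapping.single a 1 + Poly_Mapping.single b (1::nat)) 1"
  by (simp add: var_def mult_single)

lemma monomial_inj:
  "Poly_Mapping.single m (1 :: 'k::zero_neq_one) = Poly_Mapping.single n 1 \<longleftrightarrow> m = n"
  by (metis lookup_single_eq lookup_single_not_eq zero_neq_one)

lemma quadratic_monomial_eq_iff:
  "Poly_Mapping.single (a :: 'a) (1::nat) + Poly_Mapping.single b 1 =
     Poly_Mapping.single c 1 + Poly_Mapping.single d 1 \<longleftrightarrow> {a, b} = {c, d}"
proof
  assume "Poly_Mapping.single a (1::nat) + Poly_Mapping.single b 1 =
     Poly_Mapping.single c 1 + Poly_Mapping.single d 1"
  moreover have "Poly_Mapping.lookup (Poly_Mapping.single a (1::nat) + Poly_Mapping.single b 1) i \<noteq> 0 \<longleftrightarrow>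
      i \<in> {a, b}" for a b i :: 'a
    by (auto simp: Poly_Mapping.lookup_add Poly_Mapping.lookup_single when_def)
  ultimately have "i \<in> {a, b} \<longleftrightarrow> i \<in> {c, d}" for i
    by metis
  then show "{a, b} = {c, d}"
    by blast
qed (auto simp: doubleton_eq_iff add.commute)

lemma quadric_eq_0_iff:
  "(quadric a b c d :: ('a, 'k::field) mpoly) = 0 \<longleftrightarrow> {a, b} = {c, d}"
  by (simp add: var_mult quadratic_monomial_eq_iff[symmetric] monomial_inj)

text \<open>
  The two monomials are recovered as the support of the binomial. Which one carries the coefficient
  \<open>1\<close> is not recovered, since in characteristic 2 the signs agree.
\<close>

lemma quadric_eqD:
  fixes f :: "('a, 'k::field) mpoly"
  assumes "f = quadric a b c d" "f = quadric a' b' c' d'" "f \<noteq> 0"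
  shows "{a, b} = {a', b'} \<and> {c, d} = {c', d'} \<or> {a, b} = {c', d'} \<and> {c, d} = {a', b'}"
proof -
  define m where "m a b = Poly_Mapping.single a (1::nat) + Poly_Mapping.single b 1" for a b :: 'a
  have lookup: "Poly_Mapping.lookup (quadric a b c d :: ('a, 'k) mpoly) t =
      (1 when m a b = t) - (1 when m c d = t)" for a b c d t
    by (simp add: var_mult m_def Poly_Mapping.lookup_minus Poly_Mapping.lookup_single)
  have "m a b \<noteq> m c d"
    using assms(1,3) by (auto simp: m_def var_mult)
  moreover have "m a' b' \<noteq> m c' d'"
    using assms(2,3) by (auto simp: m_def var_mult)
  moreover have "Poly_Mapping.lookup f t \<noteq> 0 \<longleftrightarrow> t = m a b \<or> t = m c d" for t
    using calculation(1) by (auto simp: assms(1) lookup when_def)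
  moreover have "Poly_Mapping.lookup f t \<noteq> 0 \<longleftrightarrow> t = m a' b' \<or> t = m c' d'" for t
    using calculation(2) by (auto simp: assms(2) lookup when_def)
  ultimately have "m a b = m a' b' \<and> m c d = m c' d' \<or> m a b = m c' d' \<and> m c d = m a' b'"
    by metis
  then show ?thesis
    unfolding m_def quadratic_monomial_eq_iff .
qed

definition order_of :: "('a, 'b) gorder_scheme \<Rightarrow> 'a \<Rightarrow> 'a \<Rightarrow> bool"
  where "order_of D x y \<longleftrightarrow> x \<in> carrier D \<and> y \<in> carrier D \<and> x \<sqsubseteq>\<^bsub>D\<^esub> y"

context lattice
begin

lemma diamond_meet_join:
  assumes "x \<in> carrier L" "y \<in> carrier L" "\<not> x \<sqsubseteq> y" "\<not> y \<sqsubseteq> x"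
  shows "diamond (order_of L) x y (x \<sqinter> y) (x \<squnion> y)"
  using assms unfolding diamond_def order_of_def
  by (auto simp: meet_left meet_right join_left join_right intro: meet_le join_le)

lemma meet_join_comparable:
  assumes "x \<in> carrier L" "y \<in> carrier L" "x \<sqsubseteq> y \<or> y \<sqsubseteq> x"
  shows "{x \<squnion> y, x \<sqinter> y} = {x, y}"
proof -
  have "x \<squnion> y = y \<and> x \<sqinter> y = x" if "x \<in> carrier L" "y \<in> carrier L" "x \<sqsubseteq> y" for x y
    using that by (intro conjI le_antisym join_le meet_le)
      (auto simp: meet_left meet_right join_left join_right)
  then show ?thesis
    using assms by (metis insert_commute join_comm meet_comm)
qed

end

text \<open>
  The nonvanishing condition on a standard generator amounts to incomparability: for a comparable pair
  the join and the meet are the pair itself, and the binomial cancels.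
\<close>

lemma standard_generators_iff:
  fixes D :: "'a gorder" (structure)
  assumes "lattice D"
  shows "(f :: ('a, 'k::field) mpoly) \<in> standard_generators D \<longleftrightarrow>
    (\<exists>x\<in>carrier D. \<exists>y\<in>carrier D. \<not> x \<sqsubseteq> y \<and> \<not> y \<sqsubseteq> x \<and>
      (f = quadric x y (x \<squnion> y) (x \<sqinter> y) \<or> f = quadric (x \<squnion> y) (x \<sqinter> y) x y))"
proof -
  interpret lattice D by fact
  have "{x, y} = {x \<squnion> y, x \<sqinter> y} \<longleftrightarrow> x \<sqsubseteq> y \<or> y \<sqsubseteq> x"
    if "x \<in> carrier D" "y \<in> carrier D" for x y
    using meet_join_comparable[OF that] join_left[OF that] join_right[OF that]
    by (auto simp: doubleton_eq_iff)
  then have nonzero: "(quadric x y (x \<squnion> y) (x \<sqinter> y) :: ('a, 'k) mpoly) \<noteq> 0 \<longleftrightarrow>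
      \<not> x \<sqsubseteq> y \<and> \<not> y \<sqsubseteq> x"
    "(quadric (x \<squnion> y) (x \<sqinter> y) x y :: ('a, 'k) mpoly) \<noteq> 0 \<longleftrightarrow> \<not> x \<sqsubseteq> y \<and> \<not> y \<sqsubseteq> x"
    if "x \<in> carrier D" "y \<in> carrier D" for x y
    using that unfolding quadric_eq_0_iff by (metis)+
  have "f \<in> standard_generators D \<longleftrightarrow> (\<exists>x\<in>carrier D. \<exists>y\<in>carrier D. f \<noteq> 0 \<and>
      (f = quadric x y (x \<squnion> y) (x \<sqinter> y) \<or> f = quadric (x \<squnion> y) (x \<sqinter> y) x y))"
    unfolding standard_generators_def by blast
  also have "\<dots> \<longleftrightarrow> (\<exists>x\<in>carrier D. \<exists>y\<in>carrier D. \<not> x \<sqsubseteq> y \<and> \<not> y \<sqsubseteq> x \<and>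
      (f = quadric x y (x \<squnion> y) (x \<sqinter> y) \<or> f = quadric (x \<squnion> y) (x \<sqinter> y) x y))"
    by (intro bex_cong HOL.refl) (metis nonzero)
  finally show ?thesis .
qed

lemma square_of_generator:
  fixes D :: "'a gorder" (structure)
  assumes D: "lattice D"
    and gen: "(quadric a b c d :: ('a, 'k::field) mpoly) \<in> standard_generators D"
  shows "square (order_of D) a b c d"
proof -
  interpret lattice D by fact
  obtain x y where xy: "x \<in> carrier D" "y \<in> carrier D" "\<not> x \<sqsubseteq> y" "\<not> y \<sqsubseteq> x"
    and f: "(quadric a b c d :: ('a, 'k) mpoly) = quadric x y (x \<squnion> y) (x \<sqinter> y) \<or>
      (quadric a b c d :: ('a, 'k) mpoly) = quadric (x \<squnion> y) (x \<sqinter> y) x y"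
    using gen unfolding standard_generators_iff[OF D] by blast
  have "(quadric a b c d :: ('a, 'k) mpoly) \<noteq> 0"
    using gen by (simp add: standard_generators_def)
  then have "{a, b} = {x, y} \<and> {c, d} = {x \<squnion> y, x \<sqinter> y} \<or>
      {a, b} = {x \<squnion> y, x \<sqinter> y} \<and> {c, d} = {x, y}"
    using f quadric_eqD[OF HOL.refl] by metis
  moreover have "diamond (order_of D) x y (x \<sqinter> y) (x \<squnion> y)"
      "diamond (order_of D) y x (x \<sqinter> y) (x \<squnion> y)"
    using diamond_meet_join[OF xy] by (auto simp: diamond_def)
  ultimately show ?thesis
    unfolding square_def doubleton_eq_iff by blast
qed

theorem proposition2p27:
  shows "\<nexists>D :: nat gorder.
    lattice D \<and> carrier D = {0} \<union> {2..14} \<and>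
    up_to_sign (set (toric_generators :: (nat, 'k::field) mpoly list)) = standard_generators D"
proof (rule notI, elim exE conjE)
  fix D :: "nat gorder"
  assume D: "lattice D" and C: "carrier D = {0} \<union> {2..14}"
    and gens: "up_to_sign (set (toric_generators :: (nat, 'k) mpoly list)) = standard_generators D"
  interpret lattice D by fact
  have "square_order (order_of D)"
  proof
    fix x y z assume "order_of D x y" "order_of D y z"
    then show "order_of D x z"
      using le_trans by (auto simp: order_of_def)
  next
    fix x y assume "order_of D x y" "order_of D y x"
    then show "x = y"
      by (auto simp: order_of_def intro: le_antisym)
  next
    fix a b c d assume "(a, b, c, d) \<in> set squares"
    then have "(quadric a b c d :: (nat, 'k) mpoly) \<in> standard_generators D"
      unfolding gens[symmetric] up_to_sign_def toric_generators_squares by force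
    then show "square (order_of D) a b c d"
      by (rule square_of_generator[OF D])
  next
    fix x y assume xy: "x \<in> {0} \<union> {2..14}" "y \<in> {0} \<union> {2..14}" and "\<not> diagonal x y"
    show "order_of D x y \<or> order_of D y x"
    \<comment> \<open>An incomparable pair yields a standard generator, so its product is a monomial of
      some toric generator, and the pair is a diagonal.\<close>
    proof (rule ccontr)
      assume "\<not> ?thesis"
      then have "(quadric x y (x \<squnion>\<^bsub>D\<^esub> y) (x \<sqinter>\<^bsub>D\<^esub> y) :: (nat, 'k) mpoly) \<in> standard_generators D"
        unfolding standard_generators_iff[OF D]
        by (intro bexI[of _ x] bexI[of _ y]) (use xy C in \<open>auto simp: order_of_def\<close>)
      then have f: "(quadric x y (x \<squnion>\<^bsub>D\<^esub> y) (x \<sqinter>\<^bsub>D\<^esub> y) :: (nat, 'k) mpoly) \<noteq> 0"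
        and "(quadric x y (x \<squnion>\<^bsub>D\<^esub> y) (x \<sqinter>\<^bsub>D\<^esub> y) :: (nat, 'k) mpoly) \<in>
          up_to_sign (set toric_generators)"
        by (simp_all add: gens standard_generators_def[of D])
      then obtain a b c d where sq: "(a, b, c, d) \<in> set squares"
        and "(quadric x y (x \<squnion>\<^bsub>D\<^esub> y) (x \<sqinter>\<^bsub>D\<^esub> y) :: (nat, 'k) mpoly) = quadric a b c d \<or>
          (quadric x y (x \<squnion>\<^bsub>D\<^esub> y) (x \<sqinter>\<^bsub>D\<^esub> y) :: (nat, 'k) mpoly) = quadric c d a b"
        unfolding up_to_sign_def toric_generators_squares by fastforce
      then have "{x, y} = {a, b} \<or> {x, y} = {c, d}"
        using quadric_eqD[OF HOL.refl _ f] by blast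
      then show False
        using sq \<open>\<not> diagonal x y\<close> unfolding diagonal_def doubleton_eq_iff by blast
    qed
  qed
  then show False
    by (simp add: no_square_order)
qed

end
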